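(* Let $(G,K,\theta)$ be a multiplicity-free triple and suppose that $(\sigma,W)$ is a spherical representation, i.e. $\sigma$ is an irreducible $G$-representation contained in $\mathrm{Ind}_K^G\theta$. Let $\phi^\sigma$ be the associated spherical function. Then $$\frac{d_\sigma}{|G|}\sum_{g\in G}\phi^\sigma(g^2)=\begin{cases}1&\text{if }\sigma\text{ is real}\\-1&\text{if }\sigma\text{ is quaternionic}\\0&\text{if }\sigma\text{ is complex.}\end{cases}$$
   Context: $G$ is a finite group, $K\le G$, $(\theta,V)$ an irreducible unitary $K$-representation; $(G,K,\theta)$ is a multiplicity-free triple if $\mathrm{Ind}_K^G\theta$ contains every irreducible $G$-representation at most once. Inner products are conjugate-linear in the second argument. Fix a unit vector $v\in V$. For a (unitary) irreducible $\sigma$ contained in $\mathrm{Ind}_K^G\theta$ on the space $W$, of dimension $d_\sigma$, $\mathrm{Hom}_K(V,\mathrm{Res}^G_KW)$ is one-dimensional; let $L_\sigma:V\to W$ be an isometric operator spanning it and $w^\sigma=L_\sigma v$. The spherical function associated with $\sigma$ is $\phi^\sigma(g)=\langle w^\sigma,\sigma(g)w^\sigma\rangle_W$. The conjugate of $(\sigma,W)$ is the representation $\sigma'$ on the dual $W'$, $[\sigma'(g)w'](w)=w'(\sigma(g^{-1})w)$. $\sigma$ is complex if $\sigma\not\sim\sigma'$; it is real if $\sigma\sim\sigma'$ and its matrix coefficients with respect to a suitable orthonormal basis of $W$ are real-valued; it is quaternionic if $\sigma\sim\sigma'$ but it is not real. *)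

theory Defs
  imports Complex_Main "HOL-Algebra.Coset" "HOL-Library.Function_Algebras"
begin

text \<open>
  Complex vector spaces are given by a scalar multiplication \<open>s\<close> on a type, as in the library
  locale \<^locale>\<open>vector_space\<close>. Inner products are linear in the first and conjugate-linear in
  the second argument.
\<close>

locale complex_inner_space = vector_space scale
  for scale :: "complex \<Rightarrow> 'v::ab_group_add \<Rightarrow> 'v" +
  fixes ip :: "'v \<Rightarrow> 'v \<Rightarrow> complex"
  assumes ip_add_left: "ip (x + y) z = ip x z + ip y z"
    and ip_scale_left: "ip (scale c x) y = c * ip x y"
    and ip_commute: "ip x y = cnj (ip y x)"
    and ip_pos: "x \<noteq> 0 \<Longrightarrow> 0 < Re (ip x x)"

definition fun_scale :: "(complex \<Rightarrow> 'v \<Rightarrow> 'v) \<Rightarrow> complex \<Rightarrow> ('x \<Rightarrow> 'v) \<Rightarrow> 'x \<Rightarrow> 'v" where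
  "fun_scale s c f = (\<lambda>x. s c (f x))"

definition linear_on ::
  "(complex \<Rightarrow> 'u::ab_group_add \<Rightarrow> 'u) \<Rightarrow> (complex \<Rightarrow> 'v::ab_group_add \<Rightarrow> 'v) \<Rightarrow> 'u set \<Rightarrow> ('u \<Rightarrow> 'v) \<Rightarrow> bool"
  where
  "linear_on s t U T \<longleftrightarrow>
     (\<forall>x\<in>U. \<forall>y\<in>U. T (x + y) = T x + T y) \<and> (\<forall>c. \<forall>x\<in>U. T (s c x) = t c (T x))"

text \<open>A representation \<open>(\<rho>, U)\<close> of \<open>G\<close> on a linear subspace \<open>U\<close> of an ambient space; only the
  values \<open>\<rho> g u\<close> with \<open>g \<in> carrier G\<close> and \<open>u \<in> U\<close> matter.\<close>

definition group_rep ::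
  "('g, 'm) monoid_scheme \<Rightarrow> (complex \<Rightarrow> 'u::ab_group_add \<Rightarrow> 'u) \<Rightarrow> 'u set \<Rightarrow> ('g \<Rightarrow> 'u \<Rightarrow> 'u) \<Rightarrow> bool"
  where
  "group_rep G s U \<rho> \<longleftrightarrow>
     vector_space s \<and> module.subspace s U \<and>
     (\<forall>g\<in>carrier G. linear_on s s U (\<rho> g) \<and> \<rho> g ` U \<subseteq> U) \<and>
     (\<forall>u\<in>U. \<rho> \<one>\<^bsub>G\<^esub> u = u) \<and>
     (\<forall>g\<in>carrier G. \<forall>h\<in>carrier G. \<forall>u\<in>U. \<rho> (g \<otimes>\<^bsub>G\<^esub> h) u = \<rho> g (\<rho> h u))"

definition irreducible_rep ::
  "('g, 'm) monoid_scheme \<Rightarrow> (complex \<Rightarrow> 'u::ab_group_add \<Rightarrow> 'u) \<Rightarrow> 'u set \<Rightarrow> ('g \<Rightarrow> 'u \<Rightarrow> 'u) \<Rightarrow> bool"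
  where
  "irreducible_rep G s U \<rho> \<longleftrightarrow>
     group_rep G s U \<rho> \<and> U \<noteq> {0} \<and>
     (\<forall>S. module.subspace s S \<and> S \<subseteq> U \<and> (\<forall>g\<in>carrier G. \<rho> g ` S \<subseteq> S) \<longrightarrow> S = {0} \<or> S = U)"

definition unitary_rep ::
  "('g, 'm) monoid_scheme \<Rightarrow> ('u \<Rightarrow> 'u \<Rightarrow> complex) \<Rightarrow> ('g \<Rightarrow> 'u \<Rightarrow> 'u) \<Rightarrow> bool" where
  "unitary_rep G ip \<rho> \<longleftrightarrow> (\<forall>g\<in>carrier G. \<forall>x y. ip (\<rho> g x) (\<rho> g y) = ip x y)"

text \<open>\<open>Hom\<^sub>G(U, S)\<close>. Maps are required to vanish outside \<open>U\<close>, so that each linear map on \<open>U\<close> is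
  represented by exactly one function and the intertwiners form a subspace of the function space.\<close>

definition intertwiners ::
  "('g, 'm) monoid_scheme \<Rightarrow> (complex \<Rightarrow> 'u::ab_group_add \<Rightarrow> 'u) \<Rightarrow> 'u set \<Rightarrow> ('g \<Rightarrow> 'u \<Rightarrow> 'u) \<Rightarrow>
   (complex \<Rightarrow> 'v::ab_group_add \<Rightarrow> 'v) \<Rightarrow> 'v set \<Rightarrow> ('g \<Rightarrow> 'v \<Rightarrow> 'v) \<Rightarrow> ('u \<Rightarrow> 'v) set" where
  "intertwiners G s U \<rho> t S \<tau> =
     {T. linear_on s t U T \<and> T ` U \<subseteq> S \<and> (\<forall>u. u \<notin> U \<longrightarrow> T u = 0) \<and>
         (\<forall>g\<in>carrier G. \<forall>u\<in>U. T (\<rho> g u) = \<tau> g (T u))}"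

definition equivalent_rep ::
  "('g, 'm) monoid_scheme \<Rightarrow> (complex \<Rightarrow> 'u::ab_group_add \<Rightarrow> 'u) \<Rightarrow> 'u set \<Rightarrow> ('g \<Rightarrow> 'u \<Rightarrow> 'u) \<Rightarrow>
   (complex \<Rightarrow> 'v::ab_group_add \<Rightarrow> 'v) \<Rightarrow> 'v set \<Rightarrow> ('g \<Rightarrow> 'v \<Rightarrow> 'v) \<Rightarrow> bool" where
  "equivalent_rep G s U \<rho> t S \<tau> \<longleftrightarrow> (\<exists>T\<in>intertwiners G s U \<rho> t S \<tau>. bij_betw T U S)"

definition contained_rep ::
  "('g, 'm) monoid_scheme \<Rightarrow> (complex \<Rightarrow> 'u::ab_group_add \<Rightarrow> 'u) \<Rightarrow> 'u set \<Rightarrow> ('g \<Rightarrow> 'u \<Rightarrow> 'u) \<Rightarrow>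
   (complex \<Rightarrow> 'v::ab_group_add \<Rightarrow> 'v) \<Rightarrow> 'v set \<Rightarrow> ('g \<Rightarrow> 'v \<Rightarrow> 'v) \<Rightarrow> bool" where
  "contained_rep G s U \<rho> t S \<tau> \<longleftrightarrow> (\<exists>T\<in>intertwiners G s U \<rho> t S \<tau>. inj_on T U)"

text \<open>For irreducible \<open>\<rho>\<close>, the multiplicity of \<open>\<rho>\<close> in \<open>\<tau>\<close> is \<open>dim Hom\<^sub>G(U, S)\<close>.\<close>

definition rep_multiplicity ::
  "('g, 'm) monoid_scheme \<Rightarrow> (complex \<Rightarrow> 'u::ab_group_add \<Rightarrow> 'u) \<Rightarrow> 'u set \<Rightarrow> ('g \<Rightarrow> 'u \<Rightarrow> 'u) \<Rightarrow>
   (complex \<Rightarrow> 'v::ab_group_add \<Rightarrow> 'v) \<Rightarrow> 'v set \<Rightarrow> ('g \<Rightarrow> 'v \<Rightarrow> 'v) \<Rightarrow> nat" where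
  "rep_multiplicity G s U \<rho> t S \<tau> = vector_space.dim (fun_scale t) (intertwiners G s U \<rho> t S \<tau>)"

text \<open>\<open>Ind\<^sub>K\<^sup>G \<theta>\<close> is the space of all \<open>f : G \<rightarrow> V\<close> with \<open>f(gk) = \<theta>(k\<inverse>) f(g)\<close>, with \<open>G\<close> acting by left
  translation. Functions on \<open>G\<close> are extended by zero outside the carrier.\<close>

definition induced_space ::
  "('g, 'm) monoid_scheme \<Rightarrow> 'g set \<Rightarrow> ('g \<Rightarrow> 'v \<Rightarrow> 'v) \<Rightarrow> ('g \<Rightarrow> 'v::ab_group_add) set" where
  "induced_space G K \<theta> =
     {f. (\<forall>g\<in>carrier G. \<forall>k\<in>K. f (g \<otimes>\<^bsub>G\<^esub> k) = \<theta> (inv\<^bsub>G\<^esub> k) (f g)) \<and>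
         (\<forall>g. g \<notin> carrier G \<longrightarrow> f g = 0)}"

definition left_translation ::
  "('g, 'm) monoid_scheme \<Rightarrow> 'g \<Rightarrow> ('g \<Rightarrow> 'v::ab_group_add) \<Rightarrow> 'g \<Rightarrow> 'v" where
  "left_translation G g f = (\<lambda>x. if x \<in> carrier G then f (inv\<^bsub>G\<^esub> g \<otimes>\<^bsub>G\<^esub> x) else 0)"

text \<open>Irreducible representations of a finite group are finite-dimensional, so up to equivalence
  each of them lives on a subspace \<open>U\<close> of \<open>nat \<Rightarrow> complex\<close>. Likewise \<open>\<theta>\<close>, hence the induced
  representation, is finite-dimensional, so the multiplicities below are dimensions of
  finite-dimensional spaces.\<close>

definition multiplicity_free_triple ::
  "('g, 'm) monoid_scheme \<Rightarrow> 'g set \<Rightarrow> (complex \<Rightarrow> 'v::ab_group_add \<Rightarrow> 'v) \<Rightarrow> ('v \<Rightarrow> 'v \<Rightarrow> complex) \<Rightarrow>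
   ('g \<Rightarrow> 'v \<Rightarrow> 'v) \<Rightarrow> bool" where
  "multiplicity_free_triple G K s ip \<theta> \<longleftrightarrow>
     group G \<and> finite (carrier G) \<and> subgroup K G \<and>
     complex_inner_space s ip \<and>
     irreducible_rep (G\<lparr>carrier := K\<rparr>) s UNIV \<theta> \<and> unitary_rep (G\<lparr>carrier := K\<rparr>) ip \<theta> \<and>
     (\<forall>(U :: (nat \<Rightarrow> complex) set) \<rho>. irreducible_rep G (fun_scale (*)) U \<rho> \<longrightarrow>
        rep_multiplicity G (fun_scale (*)) U \<rho>
          (fun_scale s) (induced_space G K \<theta>) (left_translation G) \<le> 1)"

definition spherical_rep ::
  "('g, 'm) monoid_scheme \<Rightarrow> 'g set \<Rightarrow> (complex \<Rightarrow> 'v::ab_group_add \<Rightarrow> 'v) \<Rightarrow> ('g \<Rightarrow> 'v \<Rightarrow> 'v) \<Rightarrow>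
   (complex \<Rightarrow> 'w::ab_group_add \<Rightarrow> 'w) \<Rightarrow> ('w \<Rightarrow> 'w \<Rightarrow> complex) \<Rightarrow> ('g \<Rightarrow> 'w \<Rightarrow> 'w) \<Rightarrow> bool" where
  "spherical_rep G K sV \<theta> sW ipW \<sigma> \<longleftrightarrow>
     complex_inner_space sW ipW \<and> irreducible_rep G sW UNIV \<sigma> \<and> unitary_rep G ipW \<sigma> \<and>
     contained_rep G sW UNIV \<sigma> (fun_scale sV) (induced_space G K \<theta>) (left_translation G)"

text \<open>\<open>L : V \<rightarrow> W\<close> is an isometric operator spanning \<open>Hom\<^sub>K(V, Res W)\<close>.\<close>

definition spherical_isometry ::
  "('g, 'm) monoid_scheme \<Rightarrow> 'g set \<Rightarrow>
   (complex \<Rightarrow> 'v::ab_group_add \<Rightarrow> 'v) \<Rightarrow> ('v \<Rightarrow> 'v \<Rightarrow> complex) \<Rightarrow> ('g \<Rightarrow> 'v \<Rightarrow> 'v) \<Rightarrow>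
   (complex \<Rightarrow> 'w::ab_group_add \<Rightarrow> 'w) \<Rightarrow> ('w \<Rightarrow> 'w \<Rightarrow> complex) \<Rightarrow> ('g \<Rightarrow> 'w \<Rightarrow> 'w) \<Rightarrow>
   ('v \<Rightarrow> 'w) \<Rightarrow> bool" where
  "spherical_isometry G K sV ipV \<theta> sW ipW \<sigma> L \<longleftrightarrow>
     (\<forall>x y. ipW (L x) (L y) = ipV x y) \<and>
     intertwiners (G\<lparr>carrier := K\<rparr>) sV UNIV \<theta> sW UNIV \<sigma> = module.span (fun_scale sW) {L}"

definition spherical_function ::
  "('w \<Rightarrow> 'w \<Rightarrow> complex) \<Rightarrow> ('g \<Rightarrow> 'w \<Rightarrow> 'w) \<Rightarrow> ('v \<Rightarrow> 'w) \<Rightarrow> 'v \<Rightarrow> 'g \<Rightarrow> complex" where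
  "spherical_function ip \<sigma> L v g = ip (L v) (\<sigma> g (L v))"

definition dual_space :: "(complex \<Rightarrow> 'w::ab_group_add \<Rightarrow> 'w) \<Rightarrow> ('w \<Rightarrow> complex) set" where
  "dual_space s = {f. Vector_Spaces.linear s (*) f}"

definition conjugate_rep ::
  "('g, 'm) monoid_scheme \<Rightarrow> ('g \<Rightarrow> 'w \<Rightarrow> 'w) \<Rightarrow> 'g \<Rightarrow> ('w \<Rightarrow> complex) \<Rightarrow> 'w \<Rightarrow> complex" where
  "conjugate_rep G \<sigma> g f = (\<lambda>w. f (\<sigma> (inv\<^bsub>G\<^esub> g) w))"

definition self_conjugate ::
  "('g, 'm) monoid_scheme \<Rightarrow> (complex \<Rightarrow> 'w::ab_group_add \<Rightarrow> 'w) \<Rightarrow> ('g \<Rightarrow> 'w \<Rightarrow> 'w) \<Rightarrow> bool" where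
  "self_conjugate G s \<sigma> \<longleftrightarrow>
     equivalent_rep G s UNIV \<sigma> (fun_scale (*)) (dual_space s) (conjugate_rep G \<sigma>)"

definition orthonormal_basis ::
  "(complex \<Rightarrow> 'w::ab_group_add \<Rightarrow> 'w) \<Rightarrow> ('w \<Rightarrow> 'w \<Rightarrow> complex) \<Rightarrow> 'w set \<Rightarrow> bool" where
  "orthonormal_basis s ip B \<longleftrightarrow>
     (\<forall>x\<in>B. \<forall>y\<in>B. ip x y = (if x = y then 1 else 0)) \<and> module.span s B = UNIV"

definition complex_type ::
  "('g, 'm) monoid_scheme \<Rightarrow> (complex \<Rightarrow> 'w::ab_group_add \<Rightarrow> 'w) \<Rightarrow> ('g \<Rightarrow> 'w \<Rightarrow> 'w) \<Rightarrow> bool" where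
  "complex_type G s \<sigma> \<longleftrightarrow> \<not> self_conjugate G s \<sigma>"

definition real_type ::
  "('g, 'm) monoid_scheme \<Rightarrow> (complex \<Rightarrow> 'w::ab_group_add \<Rightarrow> 'w) \<Rightarrow> ('w \<Rightarrow> 'w \<Rightarrow> complex) \<Rightarrow>
   ('g \<Rightarrow> 'w \<Rightarrow> 'w) \<Rightarrow> bool" where
  "real_type G s ip \<sigma> \<longleftrightarrow>
     self_conjugate G s \<sigma> \<and>
     (\<exists>B. orthonormal_basis s ip B \<and> (\<forall>g\<in>carrier G. \<forall>x\<in>B. \<forall>y\<in>B. ip (\<sigma> g x) y \<in> \<real>))"

definition quaternionic_type ::
  "('g, 'm) monoid_scheme \<Rightarrow> (complex \<Rightarrow> 'w::ab_group_add \<Rightarrow> 'w) \<Rightarrow> ('w \<Rightarrow> 'w \<Rightarrow> complex) \<Rightarrow>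
   ('g \<Rightarrow> 'w \<Rightarrow> 'w) \<Rightarrow> bool" where
  "quaternionic_type G s ip \<sigma> \<longleftrightarrow> self_conjugate G s \<sigma> \<and> \<not> real_type G s ip \<sigma>"

end

theory Submission
  imports Defs "HOL-Computational_Algebra.Fundamental_Theorem_Algebra"
begin

text \<open>
  Here \<open>\<phi>\<^sup>\<sigma>(g\<^sup>2) = \<langle>w, \<sigma>(g\<^sup>2) w\<rangle>\<close> with the unit vector \<open>w = L v\<close>. For vectors \<open>x, y\<close> the operator
  \<open>A(x,y) u = \<Sum>\<^sub>g \<langle>x, \<sigma>(g) u\<rangle> \<sigma>(g\<inverse>) y\<close> is antilinear and commutes with \<open>\<sigma>\<close>, and for an
  orthonormal basis \<open>e\<^sub>i\<close> Parseval gives \<open>\<Sum>\<^sub>g \<langle>w, \<sigma>(g\<^sup>2) w\<rangle> = \<Sum>\<^sub>i \<langle>A(w,e\<^sub>i) e\<^sub>i, w\<rangle>\<close>. By the Riesz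
  theorem a nonzero antilinear \<open>J\<close> commuting with \<open>\<sigma>\<close> exists iff \<open>\<sigma>\<close> is self-conjugate, so the
  sum vanishes in the complex case. Otherwise Schur's lemma lets us normalise \<open>J\<close> to be antiunitary
  with \<open>J\<^sup>2 = \<lambda> = \<plusminus>1\<close>, and forces \<open>A(x,y) = (|G| \<lambda> / d) \<langle>x, J y\<rangle> J\<close>; the sum is then
  \<open>|G| \<lambda> / d\<close>. Finally \<open>\<lambda> = 1\<close> iff \<open>\<sigma>\<close> is real: an orthonormal basis of the real form
  \<open>{x. J x = x}\<close> gives real matrix coefficients, and conversely \<open>J\<close> can be taken to be complex
  conjugation of the coordinates.
\<close>

section \<open>Elementary calculus of complex inner products\<close>

context complex_inner_space
begin

lemma ip_zero_left [simp]: "ip 0 x = 0"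
  using ip_scale_left[of 0 0 x] by simp

lemma ip_zero_right [simp]: "ip x 0 = 0"
  using ip_commute[of x 0] by simp

lemma ip_add_right: "ip x (y + z) = ip x y + ip x z"
  using ip_commute[of x] ip_commute[of y] ip_commute[of z] ip_add_left by (metis complex_cnj_add)

lemma ip_scale_right: "ip x (scale c y) = cnj c * ip x y"
  by (metis complex_cnj_mult ip_commute ip_scale_left)

lemma ip_minus_left: "ip (- x) y = - ip x y"
  using ip_add_left[of x "- x" y] by (simp add: add_eq_0_iff)

lemma ip_diff_left: "ip (x - y) z = ip x z - ip y z"
  using ip_add_left[of x "- y" z] by (simp add: ip_minus_left)

lemma ip_diff_right: "ip x (y - z) = ip x y - ip x z"
  by (metis complex_cnj_diff ip_commute ip_diff_left)

lemma ip_sum_left: "ip (\<Sum>i\<in>I. f i) y = (\<Sum>i\<in>I. ip (f i) y)"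
  by (induction I rule: infinite_finite_induct) (auto simp: ip_add_left)

lemma ip_sum_right: "ip y (\<Sum>i\<in>I. f i) = (\<Sum>i\<in>I. ip y (f i))"
  by (induction I rule: infinite_finite_induct) (auto simp: ip_add_right)

lemma ip_self_eq_0 [simp]: "ip x x = 0 \<longleftrightarrow> x = 0"
  using ip_pos[of x] by force

lemma ip_self_real: "ip x x = of_real (Re (ip x x))"
  using ip_commute[of x x] by (simp add: complex_eq_iff)

lemma ip_ext: "(\<And>u. ip u x = ip u y) \<Longrightarrow> x = y"
  using ip_self_eq_0[of "x - y"] by (simp add: ip_diff_right del: ip_self_eq_0)

lemma ip_orthonormal_sum:
  assumes "finite B" "\<forall>x\<in>B. \<forall>y\<in>B. ip x y = (if x = y then 1 else 0)" "b \<in> B"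
  shows "ip (\<Sum>x\<in>B. scale (c x) x) b = c b"
proof -
  have "ip (\<Sum>x\<in>B. scale (c x) x) b = (\<Sum>x\<in>B. if x = b then c x else 0)"
    unfolding ip_sum_left ip_scale_left by (intro sum.cong) (use assms in auto)
  then show ?thesis using assms by simp
qed

lemma orthonormal_independent:
  assumes "\<forall>x\<in>B. \<forall>y\<in>B. ip x y = (if x = y then 1 else 0)"
  shows "independent B"
proof
  assume "dependent B"
  then obtain t u v where t: "finite t" "t \<subseteq> B" "(\<Sum>v\<in>t. scale (u v) v) = 0" "v \<in> t" "u v \<noteq> 0"
    unfolding dependent_explicit by blast
  have "\<forall>x\<in>t. \<forall>y\<in>t. ip x y = (if x = y then 1 else 0)"
    using assms t(2) by (meson subsetD)
  then have "ip (\<Sum>v\<in>t. scale (u v) v) v = u v"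
    using t by (intro ip_orthonormal_sum)
  with t show False by simp
qed

end

section \<open>Finite dimension: eigenvectors, orthonormal bases, the Riesz theorem\<close>

locale finite_dim_inner_space = complex_inner_space scale ip
  for scale :: "complex \<Rightarrow> 'v::ab_group_add \<Rightarrow> 'v" and ip +
  assumes finite_spanning: "\<exists>A. finite A \<and> span A = UNIV"
begin

text \<open>A linear relation among \<open>w, T w, T (T w), ...\<close> is a nonzero polynomial
  \<open>p\<close> with \<open>p(T) w = 0\<close>; splitting off roots of \<open>p\<close> one at a
  time must reach an eigenvector.\<close>

lemma finite_dim_eigenvector:
  fixes T :: "'v \<Rightarrow> 'v" and w :: 'v
  assumes T: "Vector_Spaces.linear scale scale T" and w: "w \<noteq> 0"
  shows "\<exists>a u. u \<noteq> 0 \<and> T u = scale a u"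
proof -
  interpret T: Vector_Spaces.linear scale scale T by (fact T)
  \<comment> \<open>Induction on the degree bound. If \<open>p = (X - a) q\<close> and
    \<open>u = q(T) w\<close>, then \<open>T u - a u = p(T) w = 0\<close>: either \<open>u\<close>
    is an eigenvector, or \<open>q\<close> annihilates \<open>w\<close> and has smaller
    degree.\<close>
  have step: "\<exists>a u. u \<noteq> 0 \<and> T u = scale a u"
    if "p \<noteq> 0" "degree p \<le> n" "(\<Sum>i\<le>n. scale (coeff p i) ((T ^^ i) w)) = 0" for p n
    using that
  proof (induction n arbitrary: p)
    case 0
    then have "coeff p 0 \<noteq> 0"
      by (metis leading_coeff_0_iff le_zero_eq)
    with 0 w show ?case by simp
  next
    case (Suc n)
    show ?case
    proof (cases "degree p = 0")
      case True
      then have "coeff p (Suc n) = 0" by (simp add: coeff_eq_0)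
      with Suc True show ?thesis by auto
    next
      case False
      then obtain a where a: "poly p a = 0"
        using fundamental_theorem_of_algebra constant_degree by metis
      then obtain q where q: "p = [:-a, 1:] * q"
        by (metis dvd_def poly_eq_0_iff_dvd)
      have q0: "q \<noteq> 0" using q Suc.prems by auto
      have "degree p = Suc (degree q)"
        unfolding q by (subst degree_mult_eq) (use q0 in auto)
      then have dq: "degree q \<le> n" using Suc.prems by simp
      define u where "u = (\<Sum>i\<le>n. scale (coeff q i) ((T ^^ i) w))"
      have p: "p = smult (-a) q + pCons 0 q" unfolding q by simp
      have "(\<Sum>i\<le>Suc n. scale (coeff (smult (-a) q) i) ((T ^^ i) w)) = scale (-a) u"
        using dq by (simp add: u_def scale_sum_right coeff_eq_0)
      moreover have "(\<Sum>i\<le>Suc n. scale (coeff (pCons 0 q) i) ((T ^^ i) w)) = T u"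
        by (simp add: u_def sum.atMost_Suc_shift T.sum T.scale del: sum.atMost_Suc)
      ultimately have "scale (-a) u + T u = 0"
        using Suc.prems(3) unfolding p coeff_add scale_left_distrib sum.distrib by simp
      then have "T u = scale a u"
        by (simp add: add_eq_0_iff)
      moreover have ?thesis if "u = 0"
        using Suc.IH[OF q0 dq] that unfolding u_def by simp
      ultimately show ?thesis by blast
    qed
  qed
  obtain A where A: "finite A" "span A = UNIV" using finite_spanning by blast
  define N where "N = card A"
  \<comment> \<open>Here \<open>N + 1\<close> vectors lie in the span of \<open>N\<close>. Since
    \<open>dependent\<close> speaks of sets, a repetition among the vectors is treated separately;
    the relation is then the difference of two equal ones.\<close>
  have "\<exists>c. (\<exists>i\<le>N. c i \<noteq> 0) \<and> (\<Sum>i\<le>N. scale (c i) ((T ^^ i) w)) = 0"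
  proof (cases "inj_on (\<lambda>i. (T ^^ i) w) {..N}")
    case True
    let ?S = "(\<lambda>i. (T ^^ i) w) ` {..N}"
    have "card ?S = Suc N" using True by (simp add: card_image)
    then have "dependent ?S"
      using independent_span_bound[OF A(1), of ?S] A(2) N_def by auto
    then obtain c where c: "\<exists>v\<in>?S. c v \<noteq> 0" "(\<Sum>v\<in>?S. scale (c v) v) = 0"
      by (subst (asm) dependent_finite) auto
    show ?thesis
      by (rule exI[of _ "\<lambda>i. c ((T ^^ i) w)"]) (use c True in \<open>auto simp: sum.reindex\<close>)
  next
    case False
    then obtain i j where ij: "i \<le> N" "j \<le> N" "i \<noteq> j" "(T ^^ i) w = (T ^^ j) w"
      by (auto simp: inj_on_def)
    have "(\<Sum>k\<le>N. scale (of_bool (k = i) - of_bool (k = j)) ((T ^^ k) w)) =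
        (\<Sum>k\<le>N. if k = i then (T ^^ k) w else 0) - (\<Sum>k\<le>N. if k = j then (T ^^ k) w else 0)"
      unfolding sum_subtractf[symmetric] by (intro sum.cong) (auto simp: scale_left_diff_distrib)
    then show ?thesis using ij
      by (intro exI[of _ "\<lambda>k. of_bool (k = i) - of_bool (k = j)"]) auto
  qed
  then obtain c i where c: "i \<le> N" "c i \<noteq> 0" "(\<Sum>i\<le>N. scale (c i) ((T ^^ i) w)) = 0"
    by blast
  define p where "p = (\<Sum>i\<le>N. monom (c i) i)"
  have coeff_p: "coeff p k = (if k \<le> N then c k else 0)" for k
    by (simp add: p_def coeff_sum)
  show ?thesis
  proof (rule step)
    show "p \<noteq> 0" using c coeff_p by (metis coeff_0)
    show "degree p \<le> N" by (rule degree_le) (simp add: coeff_p)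
    show "(\<Sum>i\<le>N. scale (coeff p i) ((T ^^ i) w)) = 0" using c coeff_p by simp
  qed
qed

lemma orthonormal_finite:
  assumes "\<forall>x\<in>B. \<forall>y\<in>B. ip x y = (if x = y then 1 else 0)"
  shows "finite B"
  using finite_spanning independent_span_bound orthonormal_independent[OF assms] by (metis subset_UNIV)

lemma orthonormal_basis_finite: "orthonormal_basis scale ip B \<Longrightarrow> finite B"
  unfolding orthonormal_basis_def by (blast intro: orthonormal_finite)

lemma orthonormal_basis_card:
  assumes "orthonormal_basis scale ip B"
  shows "dim UNIV = card B"
  using assms orthonormal_independent[of B]
  by (intro dim_eq_card) (auto simp: orthonormal_basis_def)

lemma orthonormal_basis_expansion:
  assumes B: "orthonormal_basis scale ip B"
  shows "(\<Sum>b\<in>B. scale (ip x b) b) = x"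
proof -
  have fin: "finite B" by (rule orthonormal_basis_finite[OF B])
  have "x \<in> span B" using B by (simp add: orthonormal_basis_def)
  then obtain c where c: "x = (\<Sum>b\<in>B. scale (c b) b)"
    using span_finite[OF fin] by auto
  have "ip x b = c b" if "b \<in> B" for b
    unfolding c by (rule ip_orthonormal_sum) (use that fin B in \<open>auto simp: orthonormal_basis_def\<close>)
  then show ?thesis using c by simp
qed

lemma parseval:
  assumes "orthonormal_basis scale ip B"
  shows "(\<Sum>b\<in>B. ip x b * ip b y) = ip x y"
proof -
  have "ip x y = ip (\<Sum>b\<in>B. scale (ip x b) b) y"
    by (simp add: orthonormal_basis_expansion[OF assms])
  then show ?thesis by (simp add: ip_sum_left ip_scale_left)
qed

lemma orthonormal_basis_ext:
  assumes B: "orthonormal_basis scale ip B" and "\<And>b. b \<in> B \<Longrightarrow> ip x b = ip y b"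
  shows "x = y"
proof -
  have "(\<Sum>b\<in>B. scale (ip x b) b) = (\<Sum>b\<in>B. scale (ip y b) b)"
    using assms by (intro sum.cong) auto
  then show ?thesis by (simp add: orthonormal_basis_expansion[OF B])
qed

text \<open>Stated for a set closed only under the operations of Gram--Schmidt with real normalisation,
  so that it applies to the real form fixed by an antilinear involution as well as to the whole space.\<close>

lemma orthonormal_basis_within:
  assumes span_F: "span F = UNIV"
    and zero: "0 \<in> F"
    and sub: "\<And>x y. x \<in> F \<Longrightarrow> y \<in> F \<Longrightarrow> x - y \<in> F"
    and proj: "\<And>x y. x \<in> F \<Longrightarrow> y \<in> F \<Longrightarrow> scale (ip x y) y \<in> F"
    and real: "\<And>x r. x \<in> F \<Longrightarrow> scale (of_real r) x \<in> F"
  obtains B where "B \<subseteq> F" "orthonormal_basis scale ip B"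
proof -
  obtain A where A: "finite A" "span A = UNIV" using finite_spanning by blast
  define P where
    "P B \<longleftrightarrow> B \<subseteq> F \<and> (\<forall>x\<in>B. \<forall>y\<in>B. ip x y = (if x = y then 1 else 0))" for B
  have bound: "card B < Suc (card A)" if "P B" for B
    using independent_span_bound[OF A(1), of B] orthonormal_independent that A(2)
    by (auto simp: P_def less_Suc_eq_le)
  have "P {}" by (simp add: P_def)
  \<comment> \<open>An orthonormal subset of \<open>F\<close> of maximal size. If it did not span
    \<open>F\<close>, one Gram-Schmidt step inside \<open>F\<close> would enlarge it.\<close>
  then obtain B where PB: "P B" and max: "\<And>C. P C \<Longrightarrow> card C \<le> card B"
    using ex_has_greatest_nat[of P "{}" card "Suc (card A)"] bound by blast
  note B = PB[unfolded P_def]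
  have fin: "finite B" using orthonormal_finite B by blast
  have "F \<subseteq> span B"
  proof (rule ccontr)
    assume "\<not> F \<subseteq> span B"
    then obtain x where x: "x \<in> F" "x \<notin> span B" by blast
    define u where "u = x - (\<Sum>b\<in>B. scale (ip x b) b)"
    have add: "a + b \<in> F" if "a \<in> F" "b \<in> F" for a b
      using sub[OF that(1) sub[OF zero that(2)]] by simp
    have sumF: "(\<Sum>b\<in>C. scale (ip x b) b) \<in> F" if "finite C" "C \<subseteq> B" for C
      using that by (induction C) (use zero add proj x B in auto)
    have uF: "u \<in> F" unfolding u_def using sub x sumF[OF fin] by blast
    have u0: "u \<noteq> 0"
    proof
      assume "u = 0"
      then have "x = (\<Sum>b\<in>B. scale (ip x b) b)" by (simp add: u_def)
      also have "\<dots> \<in> span B" by (intro span_sum span_scale span_base)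
      finally show False using x by simp
    qed
    have ub: "ip u b = 0" if "b \<in> B" for b
      using ip_orthonormal_sum[OF fin _ that, of "ip x"] B by (simp add: u_def ip_diff_left)
    define r where "r = 1 / sqrt (Re (ip u u))"
    define e where "e = scale (of_real r) u"
    have "r * r * Re (ip u u) = 1"
      using ip_pos[OF u0] by (simp add: r_def)
    then have ee: "ip e e = 1"
      unfolding e_def ip_scale_left ip_scale_right by (subst ip_self_real)
        (simp flip: of_real_mult mult.assoc)
    have eb: "ip e b = 0" "ip b e = 0" if "b \<in> B" for b
      using ub[OF that] ip_commute[of b u] by (auto simp: e_def ip_scale_left ip_scale_right)
    have "e \<notin> B" using eb(1)[of e] ee by auto
    moreover have "P (insert e B)" unfolding P_def
      using B ee eb real[OF uF] e_def \<open>e \<notin> B\<close> by auto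
    ultimately show False using max[of "insert e B"] fin by simp
  qed
  then have "span B = UNIV" using span_minimal[OF _ subspace_span, of F B] span_F by auto
  with B that show thesis unfolding orthonormal_basis_def by blast
qed

lemma orthonormal_basis_exists: obtains B where "orthonormal_basis scale ip B"
  by (rule orthonormal_basis_within[of UNIV]) auto

text \<open>Evaluating \<open>f\<close> on the basis expansion of \<open>u\<close> exhibits the
  vector; its coefficients are conjugated because \<open>ip\<close> is antilinear in the second
  argument.\<close>

lemma riesz:
  assumes "Vector_Spaces.linear scale (*) f"
  obtains y where "\<And>u. f u = ip u y"
proof -
  interpret f: Vector_Spaces.linear scale "(*)" f by (fact assms)
  obtain B where B: "orthonormal_basis scale ip B" by (rule orthonormal_basis_exists)
  have "f u = ip u (\<Sum>b\<in>B. scale (cnj (f b)) b)" for u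
  proof -
    have "f u = f (\<Sum>b\<in>B. scale (ip u b) b)" by (simp add: orthonormal_basis_expansion[OF B])
    then show ?thesis by (simp add: f.sum f.scale ip_sum_right ip_scale_right mult.commute)
  qed
  then show thesis by (rule that)
qed

end


section \<open>Antilinear maps\<close>

definition antilinear :: "(complex \<Rightarrow> 'u::ab_group_add \<Rightarrow> 'u) \<Rightarrow> ('u \<Rightarrow> 'u) \<Rightarrow> bool" where
  "antilinear s J \<longleftrightarrow> (\<forall>x y. J (x + y) = J x + J y) \<and> (\<forall>c x. J (s c x) = s (cnj c) (J x))"

lemma antilinear_add: "antilinear s J \<Longrightarrow> J (x + y) = J x + J y"
  and antilinear_scale: "antilinear s J \<Longrightarrow> J (s c x) = s (cnj c) (J x)"
  by (auto simp: antilinear_def)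

lemma antilinear_zero: "antilinear s J \<Longrightarrow> J 0 = 0"
  using antilinear_add[of s J 0 0] by simp

lemma antilinear_diff: "antilinear s J \<Longrightarrow> J (x - y) = J x - J y"
  using antilinear_add[of s J "x - y" y] by simp

context complex_inner_space
begin

text \<open>The two conjugations of scalars cancel, which brings Schur's lemma to bear on antilinear
  maps.\<close>

lemma linear_antilinear_comp:
  "antilinear scale J \<Longrightarrow> antilinear scale J' \<Longrightarrow> Vector_Spaces.linear scale scale (\<lambda>x. J (J' x))"
  by unfold_locales (auto simp: antilinear_add antilinear_scale)

end

section \<open>Irreducible unitary representations of a finite group and Schur's lemma\<close>

locale irreducible_unitary_rep = complex_inner_space scale ip + group G
  for scale :: "complex \<Rightarrow> 'v::ab_group_add \<Rightarrow> 'v" and ip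
    and G :: "('g, 'm) monoid_scheme" (structure) and \<sigma> :: "'g \<Rightarrow> 'v \<Rightarrow> 'v" +
  assumes finite_carrier: "finite (carrier G)"
    and irreducible: "irreducible_rep G scale UNIV \<sigma>"
    and unitary: "unitary_rep G ip \<sigma>"
begin

lemma rep_add: "g \<in> carrier G \<Longrightarrow> \<sigma> g (x + y) = \<sigma> g x + \<sigma> g y"
  and rep_scale: "g \<in> carrier G \<Longrightarrow> \<sigma> g (scale c x) = scale c (\<sigma> g x)"
  and rep_one: "\<sigma> \<one> x = x"
  and rep_mult: "g \<in> carrier G \<Longrightarrow> h \<in> carrier G \<Longrightarrow> \<sigma> (g \<otimes> h) x = \<sigma> g (\<sigma> h x)"
  using irreducible by (auto simp: irreducible_rep_def group_rep_def linear_on_def)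

lemma rep_zero: "g \<in> carrier G \<Longrightarrow> \<sigma> g 0 = 0"
  using rep_scale[of g 0 0] by simp

lemma rep_inv_left: "g \<in> carrier G \<Longrightarrow> \<sigma> (inv g) (\<sigma> g x) = x"
  by (metis inv_closed l_inv rep_mult rep_one)

lemma ip_rep: "g \<in> carrier G \<Longrightarrow> ip (\<sigma> g x) (\<sigma> g y) = ip x y"
  using unitary by (simp add: unitary_rep_def)

lemma ip_rep_right: "g \<in> carrier G \<Longrightarrow> ip x (\<sigma> g y) = ip (\<sigma> (inv g) x) y"
  by (metis inv_closed ip_rep rep_inv_left)

lemma ip_rep_left: "g \<in> carrier G \<Longrightarrow> ip (\<sigma> g x) y = ip x (\<sigma> (inv g) y)"
  by (metis inv_closed ip_rep rep_inv_left)

lemma invariant_subspace: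
  assumes "subspace S" "\<And>g x. g \<in> carrier G \<Longrightarrow> x \<in> S \<Longrightarrow> \<sigma> g x \<in> S"
  shows "S = {0} \<or> S = UNIV"
  using irreducible assms unfolding irreducible_rep_def by blast

lemma nontrivial: "\<exists>x::'v. x \<noteq> 0"
  using irreducible unfolding irreducible_rep_def by auto

text \<open>Finite dimension comes from irreducibility: the orbit of a nonzero vector is finite and
  spans a nonzero invariant subspace, hence everything.\<close>

sublocale finite_dim_inner_space scale ip
proof unfold_locales
  obtain w :: 'v where w: "w \<noteq> 0" using nontrivial by blast
  let ?A = "(\<lambda>g. \<sigma> g w) ` carrier G"
  have "span ?A = {0} \<or> span ?A = UNIV"
  proof (rule invariant_subspace)
    fix g x assume g: "g \<in> carrier G" and x: "x \<in> span ?A"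
    show "\<sigma> g x \<in> span ?A"
      using x
    proof (induction rule: span_induct_alt)
      case base
      then show ?case using g by (simp add: rep_zero span_zero)
    next
      case (step c y z)
      then obtain h where h: "h \<in> carrier G" "y = \<sigma> h w" by blast
      then have "\<sigma> g y \<in> ?A" using g by (auto simp flip: rep_mult)
      with step g show ?case
        by (simp add: rep_add rep_scale span_add span_scale span_base)
    qed
  qed simp
  moreover have "w \<in> span ?A" using rep_one[of w] one_closed by (metis image_eqI span_base)
  ultimately show "\<exists>A. finite A \<and> span A = UNIV"
    using w finite_carrier by (metis finite_imageI singletonD)
qed

text \<open>An eigenspace of \<open>T\<close> is invariant and nonzero, hence the whole
  space.\<close>

lemma schur:
  assumes T: "Vector_Spaces.linear scale scale T"
    and comm: "\<And>g x. g \<in> carrier G \<Longrightarrow> T (\<sigma> g x) = \<sigma> g (T x)"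
  obtains c where "\<And>x. T x = scale c x"
proof -
  interpret T: Vector_Spaces.linear scale scale T by (fact T)
  obtain a u where u: "u \<noteq> 0" "T u = scale a u"
    using finite_dim_eigenvector[OF T] nontrivial by blast
  have "{x. T x = scale a x} = {0} \<or> {x. T x = scale a x} = UNIV"
    by (intro invariant_subspace)
      (auto simp: subspace_def T.add T.scale comm rep_scale scale_right_distrib mult.commute)
  with u that show thesis by blast
qed

section \<open>Antilinear intertwiners and group averages\<close>

definition antilinear_intertwiner :: "('v \<Rightarrow> 'v) \<Rightarrow> bool" where
  "antilinear_intertwiner J \<longleftrightarrow>
     antilinear scale J \<and> (\<forall>g\<in>carrier G. \<forall>x. J (\<sigma> g x) = \<sigma> g (J x))"

lemma antilinear_intertwiner_antilinear: "antilinear_intertwiner J \<Longrightarrow> antilinear scale J"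
  by (simp add: antilinear_intertwiner_def)

lemma antilinear_intertwiner_rep:
  "antilinear_intertwiner J \<Longrightarrow> g \<in> carrier G \<Longrightarrow> J (\<sigma> g x) = \<sigma> g (J x)"
  by (simp add: antilinear_intertwiner_def)

text \<open>The composite is a linear intertwiner, so Schur's lemma applies. With
  \<open>J' = J\<close> it makes the square of \<open>J\<close> a scalar; with \<open>J'\<close>
  invertible it determines \<open>J\<close> up to a scalar.\<close>

lemma antilinear_intertwiner_comp:
  assumes "antilinear_intertwiner J" "antilinear_intertwiner J'"
  obtains c where "\<And>x. J (J' x) = scale c x"
proof (rule schur[OF linear_antilinear_comp[of J J']])
  show "antilinear scale J" "antilinear scale J'"
    using assms by (simp_all add: antilinear_intertwiner_def)
  show "J (J' (\<sigma> g x)) = \<sigma> g (J (J' x))" if "g \<in> carrier G" for g x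
    using assms that by (simp add: antilinear_intertwiner_def)
qed (rule that)

lemma linear_ip_antilinear:
  assumes "antilinear scale J"
  shows "Vector_Spaces.linear scale (*) (\<lambda>z. ip y (J z))"
  by unfold_locales
    (auto simp: antilinear_add[OF assms] antilinear_scale[OF assms] ip_add_right ip_scale_right
        algebra_simps)

lemma linear_ip_left: "Vector_Spaces.linear scale (*) (\<lambda>z. ip z y)"
  by unfold_locales (auto simp: ip_add_left ip_scale_left algebra_simps)

text \<open>The sum of the conjugates \<open>\<sigma> (inv g) \<circ> R \<circ> \<sigma> g\<close>
  of the antilinear rank-one map \<open>R u = scale (ip x u) y\<close>, not divided by the group
  order.\<close>

definition antilinear_average :: "'v \<Rightarrow> 'v \<Rightarrow> 'v \<Rightarrow> 'v" where
  "antilinear_average x y u = (\<Sum>g\<in>carrier G. scale (ip x (\<sigma> g u)) (\<sigma> (inv g) y))"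

lemma ip_antilinear_average:
  "ip (antilinear_average x y u) z = (\<Sum>g\<in>carrier G. ip x (\<sigma> g u) * ip y (\<sigma> g z))"
  unfolding antilinear_average_def ip_sum_left ip_scale_left
  by (intro sum.cong) (simp_all add: ip_rep_right)

lemma antilinear_antilinear_average: "antilinear scale (antilinear_average x y)"
  by (auto simp: antilinear_def antilinear_average_def rep_add rep_scale ip_add_right ip_scale_right
      scale_left_distrib sum.distrib scale_sum_right)

lemma antilinear_average_rep:
  assumes h: "h \<in> carrier G"
  shows "antilinear_average x y (\<sigma> h u) = \<sigma> h (antilinear_average x y u)"
proof -
  have "ip (antilinear_average x y (\<sigma> h u)) z = ip (\<sigma> h (antilinear_average x y u)) z" for z
  proof -
    have "(\<Sum>g\<in>carrier G. ip x (\<sigma> g (\<sigma> h u)) * ip y (\<sigma> g z)) =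
        (\<Sum>g\<in>carrier G. ip x (\<sigma> g u) * ip y (\<sigma> g (\<sigma> (inv h) z)))"
      \<comment> \<open>Translation invariance of the sum: the new summation variable is
        \<open>g \<otimes> h\<close>.\<close>
      by (rule sum.reindex_bij_witness[where i = "\<lambda>g. g \<otimes> inv h" and j = "\<lambda>g. g \<otimes> h"])
        (use h in \<open>simp_all add: m_assoc flip: rep_mult\<close>)
    then show ?thesis using h by (simp add: ip_antilinear_average ip_rep_left)
  qed
  then show ?thesis using ip_ext ip_commute by metis
qed

lemma antilinear_intertwiner_average: "antilinear_intertwiner (antilinear_average x y)"
  by (simp add: antilinear_intertwiner_def antilinear_antilinear_average antilinear_average_rep)

text \<open>Moving one factor \<open>\<sigma> g\<close> to the left argument lets Parseval insert
  the basis between the two factors; the resulting products are those of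
  \<open>ip_antilinear_average\<close> for \<open>x = z = w\<close> and
  \<open>y = u = b\<close>.\<close>

lemma sum_square_eq_average:
  assumes B: "orthonormal_basis scale ip B"
  shows "(\<Sum>g\<in>carrier G. ip w (\<sigma> (g [^] (2::nat)) w)) = (\<Sum>b\<in>B. ip (antilinear_average w b b) w)"
proof -
  have "ip w (\<sigma> (g [^] (2::nat)) w) = (\<Sum>b\<in>B. ip w (\<sigma> g b) * ip b (\<sigma> g w))"
    if g: "g \<in> carrier G" for g
  proof -
    have "ip w (\<sigma> (g [^] (2::nat)) w) = ip (\<sigma> (inv g) w) (\<sigma> g w)"
      using g by (simp add: numeral_2_eq_2 rep_mult ip_rep_right)
    also have "\<dots> = (\<Sum>b\<in>B. ip (\<sigma> (inv g) w) b * ip b (\<sigma> g w))"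
      by (simp add: parseval[OF B])
    finally show ?thesis using g by (simp add: ip_rep_right)
  qed
  then show ?thesis
    by (simp add: ip_antilinear_average sum.swap[of _ B])
qed

text \<open>By Schur's lemma every average is a multiple \<open>c x y\<close> of \<open>J\<close>.
  The factor is found by a kind of trace, pairing with \<open>J b\<close> over an orthonormal basis,
  and then inserted into \<open>sum_square_eq_average\<close>.\<close>

lemma sum_square_of_structure:
  assumes equiv: "antilinear_intertwiner J"
    and isom: "\<And>x y. ip (J x) (J y) = ip y x"
    and sq: "\<And>x. J (J x) = scale l x" and l: "l = 1 \<or> l = - 1"
    and w: "ip w w = 1"
  shows "of_nat (dim UNIV) / of_nat (card (carrier G)) *
      (\<Sum>g\<in>carrier G. ip w (\<sigma> (g [^] (2::nat)) w)) = l"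
proof -
  note J = antilinear_intertwiner_antilinear[OF equiv]
    and comm = antilinear_intertwiner_rep[OF equiv]
  obtain B where B: "orthonormal_basis scale ip B" by (rule orthonormal_basis_exists)
  have ll: "l * l = 1" "cnj l = l" using l by auto
  have inverse: "J (scale l (J x)) = x" "scale l (J (J x)) = x" for x
    by (simp_all add: antilinear_scale[OF J] sq ll)
  \<comment> \<open>Up to the sign \<open>l\<close>, \<open>J\<close> is its own antilinear adjoint,
    because its inverse is \<open>scale l (J x)\<close>.\<close>
  have adjoint: "ip (J x) y = l * ip (J y) x" for x y
    using isom[of x "scale l (J y)"] by (simp add: inverse ip_scale_left)
  have adjoint': "ip x (J y) = l * ip y (J x)" for x y
    by (metis adjoint complex_cnj_mult ip_commute ll(2))
  have "\<exists>c. \<forall>u. antilinear_average x y u = scale c (J u)" for x y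
  proof -
    obtain c where c: "\<And>u. antilinear_average x y (J u) = scale c u"
      by (rule antilinear_intertwiner_comp[OF antilinear_intertwiner_average equiv]) (rule that)
    have "antilinear_average x y u = scale (l * c) (J u)" for u
      using c[of "J u"] inverse(2)[of u]
        antilinear_scale[OF antilinear_antilinear_average, of x y l "J (J u)"] by (simp add: ll)
    then show ?thesis by blast
  qed
  then obtain c where c: "\<And>x y u. antilinear_average x y u = scale (c x y) (J u)"
    by metis
  define d where "d = (of_nat (dim UNIV) :: complex)"
  define n where "n = (of_nat (card (carrier G)) :: complex)"
  have n0: "n \<noteq> 0" using finite_carrier one_closed by (auto simp: n_def)
  have d: "d = of_nat (card B)" by (simp add: d_def orthonormal_basis_card[OF B])
  \<comment> \<open>Two evaluations of one sum: the vectors \<open>J b\<close> have norm one, which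
    gives \<open>d * c x y\<close>; Parseval for each fixed \<open>g\<close> gives a term
    independent of \<open>g\<close>.\<close>
  have cd: "d * c x y = n * l * ip x (J y)" for x y
  proof -
    have "d * c x y = (\<Sum>b\<in>B. ip (antilinear_average x y b) (J b))"
      using B by (simp add: c ip_scale_left isom d orthonormal_basis_def)
    also have "\<dots> = (\<Sum>g\<in>carrier G. \<Sum>b\<in>B. ip x (\<sigma> g b) * ip y (\<sigma> g (J b)))"
      unfolding ip_antilinear_average by (rule sum.swap)
    also have "\<dots> = (\<Sum>g\<in>carrier G. l * ip x (J y))"
    proof (rule sum.cong)
      fix g assume g: "g \<in> carrier G"
      have "ip y (\<sigma> g (J b)) = l * ip b (\<sigma> (inv g) (J y))" for b
        using g adjoint'[of y "\<sigma> g b"] by (simp add: comm ip_rep_left)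
      then have "(\<Sum>b\<in>B. ip x (\<sigma> g b) * ip y (\<sigma> g (J b))) =
          l * (\<Sum>b\<in>B. ip (\<sigma> (inv g) x) b * ip b (\<sigma> (inv g) (J y)))"
        using g by (simp add: ip_rep_right sum_distrib_left mult_ac)
      also have "\<dots> = l * ip x (J y)"
        using g by (simp add: parseval[OF B] ip_rep)
      finally show "(\<Sum>b\<in>B. ip x (\<sigma> g b) * ip y (\<sigma> g (J b))) = l * ip x (J y)" .
    qed simp
    finally show ?thesis by (simp add: n_def)
  qed
  have "d * (\<Sum>g\<in>carrier G. ip w (\<sigma> (g [^] (2::nat)) w)) = (\<Sum>b\<in>B. d * c w b * ip (J b) w)"
    by (simp add: sum_square_eq_average[OF B] c ip_scale_left sum_distrib_left mult.assoc)
  \<comment> \<open>One factor \<open>l\<close> comes from \<open>cd\<close> and one from each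
    adjoint rule; what remains is the squared norm of \<open>J w\<close>.\<close>
  also have "\<dots> = (\<Sum>b\<in>B. n * l * (l * l) * (ip (J w) b * ip b (J w)))"
    unfolding cd adjoint'[of w] adjoint[of _ w] by (intro sum.cong) (simp_all add: mult_ac)
  also have "\<dots> = n * l"
    by (simp only: sum_distrib_left[symmetric] parseval[OF B] isom w ll mult_1_right)
  finally show ?thesis using n0 by (simp add: d_def n_def field_simps)
qed

section \<open>Self-conjugacy and antiunitary structures\<close>

lemma injective_antilinear_intertwiner:
  assumes equiv: "antilinear_intertwiner J"
    and "J x0 \<noteq> 0" and "J x = 0"
  shows "x = 0"
proof -
  note J = antilinear_intertwiner_antilinear[OF equiv]
    and comm = antilinear_intertwiner_rep[OF equiv]
  \<comment> \<open>The kernel of an antilinear map is still a complex subspace, so irreducibility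
    applies to it.\<close>
  have "{x. J x = 0} = {0} \<or> {x. J x = 0} = UNIV"
    by (intro invariant_subspace)
      (auto simp: subspace_def antilinear_zero[OF J] antilinear_add[OF J] antilinear_scale[OF J]
        comm rep_zero)
  with assms show ?thesis by blast
qed

text \<open>The equivalence sends \<open>u\<close> to the functional \<open>ip z (J u)\<close> of
  \<open>z\<close>. It is linear in \<open>u\<close>, since \<open>J\<close> and the second argument
  of \<open>ip\<close> both conjugate scalars; it is onto by the Riesz theorem and surjectivity of
  \<open>J\<close>.\<close>

lemma self_conjugate_if_antilinear_intertwiner:
  assumes equiv: "antilinear_intertwiner J"
    and nz: "J x0 \<noteq> 0"
  shows "self_conjugate G scale \<sigma>"
proof -
  note J = antilinear_intertwiner_antilinear[OF equiv]
    and comm = antilinear_intertwiner_rep[OF equiv]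
  note inj = injective_antilinear_intertwiner[OF equiv nz]
  obtain c where c: "\<And>x. J (J x) = scale c x"
    by (rule antilinear_intertwiner_comp[OF equiv equiv]) (rule that)
  have c0: "c \<noteq> 0" using c[of x0] inj nz by auto
  have surj: "J (scale (cnj (1 / c)) (J y)) = y" for y
    using c0 by (simp add: antilinear_scale[OF J] c)
  define T where "T u = (\<lambda>z. ip z (J u))" for u
  have "T \<in> intertwiners G scale UNIV \<sigma> (fun_scale (*)) (dual_space scale) (conjugate_rep G \<sigma>)"
    by (auto simp: intertwiners_def linear_on_def T_def fun_eq_iff fun_scale_def dual_space_def
        conjugate_rep_def antilinear_add[OF J] antilinear_scale[OF J] ip_add_right ip_scale_right
        comm ip_rep_right linear_ip_left)
  moreover have "inj T"
  proof (rule injI)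
    fix x y assume "T x = T y"
    then have "J x = J y" by (intro ip_ext) (simp add: T_def fun_eq_iff)
    then show "x = y" using inj[of "x - y"] by (simp add: antilinear_diff[OF J])
  qed
  moreover have "range T = dual_space scale"
  proof
    show "range T \<subseteq> dual_space scale" by (auto simp: T_def dual_space_def linear_ip_left)
    show "dual_space scale \<subseteq> range T"
    proof
      fix f assume "f \<in> dual_space scale"
      then obtain y where "\<And>u. f u = ip u y" unfolding dual_space_def using riesz by blast
      then have "f = T (scale (cnj (1 / c)) (J y))" unfolding T_def surj by blast
      then show "f \<in> range T" by blast
    qed
  qed
  ultimately show ?thesis
    unfolding self_conjugate_def equivalent_rep_def by (auto simp: bij_betw_def)
qed

text \<open>\<open>J u\<close> is the Riesz vector of the functional \<open>T u\<close>.\<close>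

lemma antilinear_intertwiner_if_self_conjugate:
  assumes "self_conjugate G scale \<sigma>"
  obtains J x0 where "antilinear_intertwiner J" "J x0 \<noteq> 0"
proof -
  obtain T where T: "T \<in> intertwiners G scale UNIV \<sigma> (fun_scale (*)) (dual_space scale)
      (conjugate_rep G \<sigma>)"
    and bij: "bij_betw T UNIV (dual_space scale)"
    using assms unfolding self_conjugate_def equivalent_rep_def by blast
  have "T u \<in> dual_space scale" for u using bij by (auto simp: bij_betw_def)
  then have "\<exists>y. \<forall>z. T u z = ip z y" for u unfolding dual_space_def using riesz by blast
  then obtain J where J: "\<And>u z. T u z = ip z (J u)" by metis
  have T_add: "T (x + y) z = T x z + T y z" and T_scale: "T (scale c x) z = c * T x z"
    and T_rep: "g \<in> carrier G \<Longrightarrow> T (\<sigma> g x) z = T x (\<sigma> (inv g) z)" for x y z c g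
    using T by (auto simp: intertwiners_def linear_on_def fun_scale_def conjugate_rep_def)
  have anti: "antilinear scale J" unfolding antilinear_def
    by (intro conjI allI; rule ip_ext) (auto simp: J[symmetric] ip_add_right ip_scale_right T_add T_scale)
  have "J (\<sigma> g x) = \<sigma> g (J x)" if "g \<in> carrier G" for g x
    using that by (intro ip_ext) (simp add: J[symmetric] T_rep ip_rep_right)
  with anti have "antilinear_intertwiner J" by (simp add: antilinear_intertwiner_def)
  moreover obtain x0 where "J x0 \<noteq> 0"
  proof -
    obtain x0 :: 'v where "x0 \<noteq> 0" using nontrivial by blast
    then have "T x0 \<noteq> T 0" using bij by (auto simp: bij_betw_def inj_on_def)
    then have "J x0 \<noteq> J 0" by (auto simp: J fun_eq_iff)
    then show thesis using that by (simp add: antilinear_zero[OF anti])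
  qed
  ultimately show thesis by (rule that)
qed

text \<open>The operator \<open>A\<close>, the adjoint of \<open>J0\<close> composed with
  \<open>J0\<close>, is linear and commutes with \<sigma>, hence is a scalar. This scalar is real
  and positive, so rescaling makes \<open>J0\<close> antiunitary.\<close>

lemma self_conjugate_structure:
  assumes "self_conjugate G scale \<sigma>"
  obtains J l where "antilinear_intertwiner J" "\<And>x y. ip (J x) (J y) = ip y x"
    "\<And>x. J (J x) = scale l x" "l = 1 \<or> l = - 1"
proof -
  obtain J0 x0 where equiv0: "antilinear_intertwiner J0" and nz: "J0 x0 \<noteq> 0"
    by (rule antilinear_intertwiner_if_self_conjugate[OF assms])
  note J0 = antilinear_intertwiner_antilinear[OF equiv0]
    and comm0 = antilinear_intertwiner_rep[OF equiv0]
  have "\<exists>y. \<forall>z. ip (J0 x) (J0 z) = ip z y" for x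
    using riesz[OF linear_ip_antilinear[OF J0]] by metis
  then obtain A where A: "\<And>x z. ip z (A x) = ip (J0 x) (J0 z)" by metis
  have lin: "Vector_Spaces.linear scale scale A"
    by unfold_locales
      (rule ip_ext, simp add: A ip_add_right ip_scale_right ip_add_left ip_scale_left
        antilinear_add[OF J0] antilinear_scale[OF J0])+
  have "A (\<sigma> g x) = \<sigma> g (A x)" if g: "g \<in> carrier G" for g x
    using g by (intro ip_ext) (simp add: A ip_rep_right comm0)
  then obtain a where a: "\<And>x. A x = scale a x" using schur[OF lin] by metis
  have ipJ0: "ip (J0 x) (J0 y) = cnj a * ip y x" for x y
    using A[of y x] by (simp add: a ip_scale_right)
  \<comment> \<open>The scalar of \<open>A\<close>, read off as a ratio of squared norms, which
    shows that it is positive.\<close>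
  define r where "r = Re (ip (J0 x0) (J0 x0)) / Re (ip x0 x0)"
  have x0: "x0 \<noteq> 0" using nz antilinear_zero[OF J0] by auto
  have "of_real (Re (ip (J0 x0) (J0 x0))) = cnj a * of_real (Re (ip x0 x0))"
    using ipJ0[of x0 x0] ip_self_real by metis
  then have ra: "cnj a = of_real r" using ip_pos[OF x0] by (simp add: r_def field_simps)
  have r: "r > 0" unfolding r_def using ip_pos[OF x0] ip_pos[OF nz] by simp
  define k where "k = 1 / sqrt r"
  have k: "k * k * r = 1" using r by (simp add: k_def)
  define J where "J x = scale (of_real k) (J0 x)" for x
  have J: "antilinear scale J"
    by (simp add: antilinear_def J_def antilinear_add[OF J0] antilinear_scale[OF J0]
        scale_right_distrib mult.commute)
  have equiv: "antilinear_intertwiner J"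
    using J by (simp add: antilinear_intertwiner_def J_def comm0 rep_scale)
  have isom: "ip (J x) (J y) = ip y x" for x y
    using k by (simp add: J_def ip_scale_left ip_scale_right ipJ0 ra flip: of_real_mult mult.assoc)
  obtain l where l: "\<And>x. J (J x) = scale l x"
    by (rule antilinear_intertwiner_comp[OF equiv equiv]) (rule that)
  \<comment> \<open>\<open>J (J (J x0))\<close> is computed in two ways, applying the scalar square
    outside or inside; hence \<open>l\<close> is real.\<close>
  have "scale (cnj l) (J x0) = scale l (J x0)"
    using l[of "J x0"] antilinear_scale[OF J, of l x0] by (simp add: l)
  moreover have "J x0 \<noteq> 0" using isom[of x0 x0] x0 by auto
  ultimately have cnj_l: "cnj l = l" by simp
  have "ip (J (J x0)) (J (J x0)) = ip x0 x0" by (simp add: isom)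
  then have "l * l = 1" using x0 by (simp add: l ip_scale_left ip_scale_right cnj_l)
  then have "l = 1 \<or> l = - 1" by (simp add: square_eq_1_iff)
  with equiv isom l show thesis by (rule that)
qed

section \<open>Real type and real structures\<close>

lemma real_structure_if_real_type:
  assumes "real_type G scale ip \<sigma>"
  obtains J where "antilinear_intertwiner J" "\<And>x y. ip (J x) (J y) = ip y x"
    "\<And>x. J (J x) = scale 1 x"
proof -
  obtain B where B: "orthonormal_basis scale ip B"
    and real: "\<And>g x y. g \<in> carrier G \<Longrightarrow> x \<in> B \<Longrightarrow> y \<in> B \<Longrightarrow> ip (\<sigma> g x) y \<in> \<real>"
    using assms unfolding real_type_def by blast
  \<comment> \<open>Complex conjugation of the coordinates with respect to \<open>B\<close>:
    \<open>ip b u\<close> is the conjugate of the coordinate \<open>ip u b\<close>.\<close>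
  define J where "J u = (\<Sum>b\<in>B. scale (ip b u) b)" for u
  have ipJ: "ip (J u) b = ip b u" if "b \<in> B" for u b
    unfolding J_def
    by (rule ip_orthonormal_sum)
      (use that B orthonormal_basis_finite[OF B] in \<open>auto simp: orthonormal_basis_def\<close>)
  have ipJ': "ip b (J u) = ip u b" if "b \<in> B" for u b
    using ipJ[OF that, of u] ip_commute by metis
  have anti: "antilinear scale J"
    by (simp add: antilinear_def J_def ip_add_right ip_scale_right scale_left_distrib sum.distrib
        scale_sum_right)
  have "J (\<sigma> g x) = \<sigma> g (J x)" if g: "g \<in> carrier G" for g x
  proof (rule orthonormal_basis_ext[OF B])
    fix b assume b: "b \<in> B"
    \<comment> \<open>Real matrix coefficients allow the arguments to be exchanged; this is what
      makes \<open>J\<close> commute with \<sigma>.\<close>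
    have real': "ip (\<sigma> (inv g) b) e = ip e (\<sigma> (inv g) b)" if "e \<in> B" for e
      using real[of "inv g" b e] that b g ip_commute[of e "\<sigma> (inv g) b"] by (simp add: Reals_cnj_iff)
    have "ip (J (\<sigma> g x)) b = ip (\<sigma> (inv g) b) x"
      using b g by (simp add: ipJ ip_rep_right)
    also have "\<dots> = (\<Sum>e\<in>B. ip (\<sigma> (inv g) b) e * ip e x)" by (simp add: parseval[OF B])
    also have "\<dots> = (\<Sum>e\<in>B. ip (J x) e * ip e (\<sigma> (inv g) b))"
      by (intro sum.cong) (auto simp: ipJ real')
    also have "\<dots> = ip (\<sigma> g (J x)) b"
      using g by (simp add: parseval[OF B] ip_rep_left)
    finally show "ip (J (\<sigma> g x)) b = ip (\<sigma> g (J x)) b" .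
  qed
  with anti have "antilinear_intertwiner J" by (simp add: antilinear_intertwiner_def)
  moreover have "ip (J x) (J y) = ip y x" for x y
  proof -
    have "(\<Sum>b\<in>B. ip (J x) b * ip b (J y)) = (\<Sum>b\<in>B. ip y b * ip b x)"
      by (intro sum.cong) (auto simp: ipJ ipJ')
    then show ?thesis by (simp add: parseval[OF B])
  qed
  moreover have "J (J x) = scale 1 x" for x
    by (rule orthonormal_basis_ext[OF B]) (simp add: ipJ ipJ')
  ultimately show thesis by (rule that)
qed

text \<open>The fixed points of \<open>J\<close> are a real form: \<sigma> preserves them, their
  inner products are real, and they span everything over the complex numbers. An orthonormal basis
  chosen among them has real matrix coefficients.\<close>

lemma real_type_if_real_structure:
  assumes "self_conjugate G scale \<sigma>"
    and equiv: "antilinear_intertwiner J"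
    and isom: "\<And>x y. ip (J x) (J y) = ip y x" and sq: "\<And>x. J (J x) = x"
  shows "real_type G scale ip \<sigma>"
proof -
  note J = antilinear_intertwiner_antilinear[OF equiv]
    and comm = antilinear_intertwiner_rep[OF equiv]
  let ?F = "{x. J x = x}"
  have cnj_fixed: "cnj (ip x y) = ip x y" if "J x = x" "J y = y" for x y
    using isom[of x y] that ip_commute[of y x] by simp
  have "x \<in> span ?F" for x
  proof -
    \<comment> \<open>The real and imaginary parts of \<open>x\<close> with respect to
      \<open>J\<close>, up to scalar factors.\<close>
    have "x + J x \<in> ?F" by (simp add: antilinear_add[OF J] sq add.commute)
    moreover have "scale \<i> (x - J x) \<in> ?F"
      by (simp add: antilinear_scale[OF J] antilinear_diff[OF J] sq scale_right_diff_distrib)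
    ultimately have "scale (1 / 2) (x + J x) + scale (- \<i> / 2) (scale \<i> (x - J x)) \<in> span ?F"
      by (intro span_add span_scale span_base)
    also have "scale (1 / 2) (x + J x) + scale (- \<i> / 2) (scale \<i> (x - J x)) = x"
      by (simp add: scale_right_distrib scale_right_diff_distrib flip: scale_left_distrib)
    finally show ?thesis .
  qed
  then have "span ?F = UNIV" by blast
  then obtain B where "B \<subseteq> ?F" and B: "orthonormal_basis scale ip B"
    by (rule orthonormal_basis_within)
      (auto simp: antilinear_zero[OF J] antilinear_diff[OF J] antilinear_scale[OF J] cnj_fixed)
  then have "ip (\<sigma> g x) y \<in> \<real>" if "g \<in> carrier G" "x \<in> B" "y \<in> B" for g x y
    using that comm[of g x] cnj_fixed[of "\<sigma> g x" y] by (auto simp: Reals_cnj_iff subset_iff)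
  with B assms(1) show ?thesis unfolding real_type_def by blast
qed

section \<open>The Frobenius-Schur trichotomy for a diagonal coefficient at a unit vector\<close>

theorem frobenius_schur_single_vector:
  assumes w: "ip w w = 1"
  defines "S \<equiv> of_nat (dim UNIV) / of_nat (card (carrier G)) *
      (\<Sum>g\<in>carrier G. ip w (\<sigma> (g [^] (2::nat)) w))"
  shows "real_type G scale ip \<sigma> \<Longrightarrow> S = 1"
    and "quaternionic_type G scale ip \<sigma> \<Longrightarrow> S = - 1"
    and "complex_type G scale \<sigma> \<Longrightarrow> S = 0"
proof -
  show "S = 1" if "real_type G scale ip \<sigma>"
  proof -
    obtain J where J: "antilinear_intertwiner J" "\<And>x y. ip (J x) (J y) = ip y x"
      "\<And>x. J (J x) = scale 1 x"
      by (rule real_structure_if_real_type[OF \<open>real_type G scale ip \<sigma>\<close>]) (rule that)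
    from sum_square_of_structure[OF J _ w] show ?thesis by (simp add: S_def)
  qed
  show "S = - 1" if q: "quaternionic_type G scale ip \<sigma>"
  proof -
    have sc: "self_conjugate G scale \<sigma>" and nr: "\<not> real_type G scale ip \<sigma>"
      using q by (auto simp: quaternionic_type_def)
    obtain J l where J: "antilinear_intertwiner J" "\<And>x y. ip (J x) (J y) = ip y x"
      "\<And>x. J (J x) = scale l x" "l = 1 \<or> l = - 1"
      by (rule self_conjugate_structure[OF sc]) (rule that)
    \<comment> \<open>Square \<open>1\<close> would make \<open>J\<close> a real structure, excluded
      in the quaternionic case.\<close>
    have "l \<noteq> 1" using real_type_if_real_structure[OF sc J(1,2)] J(3) nr by auto
    then show ?thesis using sum_square_of_structure[OF J w] J(4) by (simp add: S_def)
  qed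
  show "S = 0" if "complex_type G scale \<sigma>"
  proof -
    obtain B where B: "orthonormal_basis scale ip B" by (rule orthonormal_basis_exists)
    \<comment> \<open>A nonzero average would be an antilinear intertwiner that forces
      self-conjugacy.\<close>
    have "antilinear_average x y u = 0" for x y u
      using self_conjugate_if_antilinear_intertwiner[OF antilinear_intertwiner_average] that
      unfolding complex_type_def by blast
    then show ?thesis by (simp add: S_def sum_square_eq_average[OF B])
  qed
qed

end

theorem theorem4p25:
  fixes G :: "('g, 'm) monoid_scheme" and K :: "'g set"
    and sV :: "complex \<Rightarrow> 'v::ab_group_add \<Rightarrow> 'v" and ipV :: "'v \<Rightarrow> 'v \<Rightarrow> complex"
    and \<theta> :: "'g \<Rightarrow> 'v \<Rightarrow> 'v" and v :: 'v
    and sW :: "complex \<Rightarrow> 'w::ab_group_add \<Rightarrow> 'w" and ipW :: "'w \<Rightarrow> 'w \<Rightarrow> complex"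
    and \<sigma> :: "'g \<Rightarrow> 'w \<Rightarrow> 'w" and L :: "'v \<Rightarrow> 'w"
  assumes "multiplicity_free_triple G K sV ipV \<theta>"
    and "ipV v v = 1"
    and "spherical_rep G K sV \<theta> sW ipW \<sigma>"
    and "spherical_isometry G K sV ipV \<theta> sW ipW \<sigma> L"
  defines "S \<equiv> of_nat (vector_space.dim sW UNIV) / of_nat (card (carrier G)) *
      (\<Sum>g\<in>carrier G. spherical_function ipW \<sigma> L v (g [^]\<^bsub>G\<^esub> (2::nat)))"
  shows "(real_type G sW ipW \<sigma> \<longrightarrow> S = 1) \<and>
    (quaternionic_type G sW ipW \<sigma> \<longrightarrow> S = - 1) \<and>
    (complex_type G sW \<sigma> \<longrightarrow> S = 0)"
proof -
  interpret irreducible_unitary_rep sW ipW G \<sigma>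
    using assms(1,3)
    by (auto simp: irreducible_unitary_rep_def irreducible_unitary_rep_axioms_def
        multiplicity_free_triple_def spherical_rep_def)
  \<comment> \<open>Since \<open>L\<close> is isometric, the spherical function is a diagonal
    coefficient at a unit vector.\<close>
  have "ipW (L v) (L v) = 1" using assms(2,4) by (simp add: spherical_isometry_def)
  from frobenius_schur_single_vector[OF this] show ?thesis
    unfolding S_def spherical_function_def by blast
qed

end
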